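(* Let $G$ be a graph with $m=|E(G)|$ edges, let $e$ be the minimum size of an edge-cut separating $s$ from $r$, and let $c_e$ be the number of edge-cuts of size $e$ separating $s$ from $r$. Write $q=1-p$. Let $A_1$ be a finite protocol for which there is $\varepsilon>0$ with $\hat\rho(G,p)=\rho_{A_1}(G,p)$ for all $p\in(1-\varepsilon,1)$ (an optimal finite protocol near one). Then $\hat\rho(G,p)=\rho_{A_1}(G,p)$ for all $p$ with $q<3^{-m}$, and $\rho_{A_1}(G,p)=1-c_eq^e+O(q^{e+1})$ as $q\to 0$.
   Context: Graphs are finite, undirected, simple, with distinguished sender $s$ and receiver $r$. Each edge survives independently with the same probability $p\in(0,1)$ (fails with probability $q=1-p$). An instruction is a triple $uvw$ with $u,w$ distinct neighbors of $v$; a protocol $A$ is a set of instructions; an $A$-walk is an $s,r$-walk all of whose consecutive triples $v_{i-1}v_iv_{i+1}$ lie in $A$; $A$ is finite if there are finitely many $A$-walks; $\rho_A(G,p)$ is the probability that all edges of some $A$-walk survive; $\hat\rho(G,p)=\max\{\rho_A(G,p):A$ finite protocol$\}$. *)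

theory Defs
  imports "HOL-Probability.Probability" "HOL-Library.Landau_Symbols"
begin

definition simple_graph :: "'v set \<Rightarrow> 'v set set \<Rightarrow> bool" where
  "simple_graph V E \<longleftrightarrow> finite V \<and> (\<forall>e\<in>E. e \<subseteq> V \<and> card e = 2)"

definition instructions :: "'v set set \<Rightarrow> ('v \<times> 'v \<times> 'v) set" where
  "instructions E = {(u, v, w). {u, v} \<in> E \<and> {v, w} \<in> E \<and> u \<noteq> w}"

(* Walks are lists of vertices; vertices and edges may repeat, and s and r may also
   occur in the interior. *)
definition walk :: "'v set set \<Rightarrow> 'v \<Rightarrow> 'v \<Rightarrow> 'v list \<Rightarrow> bool" where
  "walk E s r xs \<longleftrightarrow> xs \<noteq> [] \<and> hd xs = s \<and> last xs = r \<and>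
     (\<forall>i. i + 1 < length xs \<longrightarrow> {xs ! i, xs ! (i + 1)} \<in> E)"

definition walk_edges :: "'v list \<Rightarrow> 'v set set" where
  "walk_edges xs = {{xs ! i, xs ! (i + 1)} | i. i + 1 < length xs}"

definition protocol_walks :: "'v set set \<Rightarrow> 'v \<Rightarrow> 'v \<Rightarrow> ('v \<times> 'v \<times> 'v) set \<Rightarrow> 'v list set" where
  "protocol_walks E s r A =
     {xs. walk E s r xs \<and>
        (\<forall>i. i + 2 < length xs \<longrightarrow> (xs ! i, xs ! (i + 1), xs ! (i + 2)) \<in> A)}"

definition finite_protocol :: "'v set set \<Rightarrow> 'v \<Rightarrow> 'v \<Rightarrow> ('v \<times> 'v \<times> 'v) set \<Rightarrow> bool" where
  "finite_protocol E s r A \<longleftrightarrow> A \<subseteq> instructions E \<and> finite (protocol_walks E s r A)"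

(* Independent Bernoulli(p) survival indicators for the edges (True = survives).
   Outside the range 0 \<le> p \<le> 1, bernoulli_pmf truncates its parameter. *)
definition survival_pmf :: "'v set set \<Rightarrow> real \<Rightarrow> ('v set \<Rightarrow> bool) pmf" where
  "survival_pmf E p = Pi_pmf E False (\<lambda>_. bernoulli_pmf p)"

definition rho :: "'v set set \<Rightarrow> 'v \<Rightarrow> 'v \<Rightarrow> ('v \<times> 'v \<times> 'v) set \<Rightarrow> real \<Rightarrow> real" where
  "rho E s r A p =
     measure_pmf.prob (survival_pmf E p)
       {\<omega>. \<exists>xs\<in>protocol_walks E s r A. \<forall>e\<in>walk_edges xs. \<omega> e}"

definition rho_hat :: "'v set set \<Rightarrow> 'v \<Rightarrow> 'v \<Rightarrow> real \<Rightarrow> real" where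
  "rho_hat E s r p = Max ((\<lambda>A. rho E s r A p) ` {A. finite_protocol E s r A})"

(* The edge-cut [S, V - S]. *)
definition cut_edges :: "'v set \<Rightarrow> 'v set set \<Rightarrow> 'v set \<Rightarrow> 'v set set" where
  "cut_edges V E S = {e \<in> E. \<exists>u\<in>S. \<exists>v\<in>V - S. e = {u, v}}"

(* Cuts are counted as edge sets: different S may give the same cut. *)
definition separating_cuts :: "'v set \<Rightarrow> 'v set set \<Rightarrow> 'v \<Rightarrow> 'v \<Rightarrow> 'v set set set" where
  "separating_cuts V E s r = {cut_edges V E S | S. S \<subseteq> V \<and> s \<in> S \<and> r \<notin> S}"

definition min_cut_size :: "'v set \<Rightarrow> 'v set set \<Rightarrow> 'v \<Rightarrow> 'v \<Rightarrow> nat" where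
  "min_cut_size V E s r = Min (card ` separating_cuts V E s r)"

definition num_cuts :: "'v set \<Rightarrow> 'v set set \<Rightarrow> 'v \<Rightarrow> 'v \<Rightarrow> nat \<Rightarrow> nat" where
  "num_cuts V E s r k = card {C \<in> separating_cuts V E s r. card C = k}"

(* The maximum and minimum above range over finite nonempty sets. *)

lemma finite_edges:
  assumes "simple_graph V E" shows "finite E"
proof (rule finite_subset)
  show "E \<subseteq> Pow V" using assms by (auto simp: simple_graph_def)
  show "finite (Pow V)" using assms by (simp add: simple_graph_def)
qed

lemma finite_finite_protocols:
  assumes "simple_graph V E" shows "finite {A. finite_protocol E s r A}"
proof (rule finite_subset)
  have "instructions E \<subseteq> V \<times> V \<times> V"
    using assms by (auto simp: instructions_def simple_graph_def)
  then show "{A. finite_protocol E s r A} \<subseteq> Pow (V \<times> V \<times> V)"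
    by (auto simp: finite_protocol_def)
  show "finite (Pow (V \<times> V \<times> V))" using assms by (simp add: simple_graph_def)
qed

lemma finite_protocol_empty: "finite_protocol E s r {}"
proof -
  have "xs \<in> {[s], [s, r]}" if "xs \<in> protocol_walks E s r {}" for xs
  proof -
    have w: "xs \<noteq> []" "hd xs = s" "last xs = r" "\<not> 2 < length xs"
      using that by (auto simp: protocol_walks_def walk_def numeral_2_eq_2 dest: spec[of _ 0])
    then show ?thesis
      by (cases xs; cases "tl xs"; cases "tl (tl xs)") auto
  qed
  then have "finite (protocol_walks E s r {})"
    by (meson finite.emptyI finite.insertI finite_subset subsetI)
  then show ?thesis by (simp add: finite_protocol_def)
qed

lemma finite_separating_cuts:
  assumes "simple_graph V E" shows "finite (separating_cuts V E s r)"
proof (rule finite_subset)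
  show "separating_cuts V E s r \<subseteq> cut_edges V E ` Pow V"
    by (auto simp: separating_cuts_def)
  show "finite (cut_edges V E ` Pow V)" using assms by (simp add: simple_graph_def)
qed

lemma separating_cuts_nonempty:
  assumes "s \<in> V" "s \<noteq> r" shows "separating_cuts V E s r \<noteq> {}"
proof -
  have "cut_edges V E {s} \<in> separating_cuts V E s r"
    using assms by (auto simp: separating_cuts_def)
  then show ?thesis by blast
qed

end

theory Submission
  imports Defs
begin

text \<open>The reliability of a protocol is a polynomial \<open>\<Sum>\<^sub>k d\<^sub>k q\<^sup>k (1 - q)\<^sup>m\<^sup>-\<^sup>k\<close> with integers
  \<open>0 \<le> d\<^sub>k \<le> binomial m k\<close>; for the difference of two of these, the first nonzero coefficient decides
  the sign for all \<open>q < 3\<^sup>-\<^sup>m\<close>.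

  For the expansion it suffices to find a finite protocol that survives every set of at most \<open>e\<close>
  failures that is not a cut. Take an acyclic flow of value \<open>e\<close> and a ranking of the edges. Besides
  the flow arcs, use an arc \<open>xy\<close> outside the flow if it is the lowest-ranked such arc leaving some
  vertex set that no flow arc enters. Walks along these arcs that never turn back immediately do
  not revisit a vertex. If the set \<open>R\<close> reachable from \<open>s\<close> after the failures \<open>F\<close> missed \<open>r\<close>, then \<open>F\<close>
  would be exactly the set of the \<open>e\<close> flow edges leaving \<open>R\<close>; as \<open>F\<close> is not a cut, an edge
  outside the flow leaves \<open>R\<close>, and the lowest-ranked one is usable, a contradiction.\<close>

section \<open>Acyclic flows\<close>

lemma rtrancl_distinct_path:
  assumes "(x, y) \<in> R\<^sup>*"
  obtains xs where "xs \<noteq> []" "hd xs = x" "last xs = y" "distinct xs"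
    "successively (\<lambda>u v. (u, v) \<in> R) xs"
proof -
  from assms have "\<exists>xs. xs \<noteq> [] \<and> hd xs = x \<and> last xs = y \<and> distinct xs \<and>
    successively (\<lambda>u v. (u, v) \<in> R) xs"
  proof (induction rule: rtrancl_induct)
    case base
    show ?case by (rule exI[of _ "[x]"]) simp
  next
    case (step y z)
    then obtain xs where xs: "xs \<noteq> []" "hd xs = x" "last xs = y" "distinct xs"
      "successively (\<lambda>u v. (u, v) \<in> R) xs" by blast
    show ?case
    proof (cases "z \<in> set xs")
      case True
      then obtain as bs where ab: "xs = as @ z # bs" by (meson split_list)
      show ?thesis
        by (rule exI[of _ "as @ [z]"])
          (use xs in \<open>auto simp: ab successively_append_iff hd_append successively_Cons\<close>)
    next
      case False
      show ?thesis
        by (rule exI[of _ "xs @ [z]"])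
          (use xs step False in \<open>auto simp: successively_append_iff\<close>)
    qed
  qed
  then show thesis using that by blast
qed

section \<open>Arcs of a path and divergence of arc sets\<close>

definition path_arcs :: "'v list \<Rightarrow> ('v \<times> 'v) set" where
  "path_arcs xs = set (zip xs (tl xs))"

lemma path_arcs_Cons2: "path_arcs (x # y # xs) = insert (x, y) (path_arcs (y # xs))"
  by (simp add: path_arcs_def)

lemma finite_path_arcs [simp]: "finite (path_arcs xs)"
  by (simp add: path_arcs_def)

lemma path_arcs_subset:
  "successively (\<lambda>u v. (u, v) \<in> R) xs \<Longrightarrow> path_arcs xs \<subseteq> R"
  by (induction xs rule: induct_list012) (auto simp: path_arcs_def)

lemma path_arcs_fst: "(u, v) \<in> path_arcs xs \<Longrightarrow> u \<in> set xs"
  by (auto simp: path_arcs_def dest: set_zip_leftD)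

text \<open>Guarantees that an arc closing a path into a cycle is new.\<close>

lemma path_arcs_last: "distinct xs \<Longrightarrow> (last xs, v) \<notin> path_arcs xs"
proof (induction xs rule: induct_list012)
  case (3 x y zs)
  then show ?case by (auto simp: path_arcs_Cons2)
qed (auto simp: path_arcs_def)

text \<open>Net outflow at \<open>v\<close> when each arc of \<open>\<Phi>\<close> carries one
  unit.\<close>

definition divergence :: "('v \<times> 'v) set \<Rightarrow> 'v \<Rightarrow> int" where
  "divergence \<Phi> v = (\<Sum>a\<in>\<Phi>. of_bool (fst a = v) - of_bool (snd a = v))"

lemma divergence_Un:
  assumes "finite A" "finite B" "A \<inter> B = {}"
  shows "divergence (A \<union> B) v = divergence A v + divergence B v"
  using assms by (simp add: divergence_def sum.union_disjoint)

lemma divergence_split: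
  assumes "finite A"
  shows "divergence A v = divergence (A - B) v + divergence (A \<inter> B) v"
proof -
  have "A = (A - B) \<union> (A \<inter> B)" by blast
  then show ?thesis using divergence_Un[of "A - B" "A \<inter> B" v] assms by fastforce
qed

lemma divergence_converse: "divergence (A\<inverse>) v = - divergence A v"
proof -
  have *: "A\<inverse> = prod.swap ` A" by force
  show ?thesis
    unfolding divergence_def *
    by (subst sum.reindex) (auto simp: o_def inj_on_def sum_negf[symmetric] intro!: sum.cong)
qed

lemma divergence_path:
  assumes "xs \<noteq> []" "distinct xs"
  shows "divergence (path_arcs xs) v = of_bool (v = hd xs) - of_bool (v = last xs)"
  using assms
proof (induction xs rule: induct_list012)
  case (3 x y zs)
  have "(x, y) \<notin> path_arcs (y # zs)" using 3 path_arcs_fst by fastforce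
  then have "divergence (path_arcs (x # y # zs)) v =
      of_bool (x = v) - of_bool (y = v) + divergence (path_arcs (y # zs)) v"
    by (simp add: path_arcs_Cons2 divergence_def)
  then show ?case using 3 by auto
qed (auto simp: divergence_def path_arcs_def)

text \<open>After the sums are exchanged, the two contributions of an arc with both ends in
  \<open>S\<close> cancel, and only boundary arcs remain.\<close>

lemma sum_divergence:
  assumes "finite S" "finite \<Phi>"
  shows "(\<Sum>v\<in>S. divergence \<Phi> v) =
    int (card {(u, v) \<in> \<Phi>. u \<in> S \<and> v \<notin> S}) - int (card {(u, v) \<in> \<Phi>. u \<notin> S \<and> v \<in> S})"
proof -
  have "(\<Sum>v\<in>S. divergence \<Phi> v) = (\<Sum>a\<in>\<Phi>. of_bool (fst a \<in> S) - of_bool (snd a \<in> S))"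
    unfolding divergence_def
    by (subst sum.swap) (simp add: sum_subtractf assms of_bool_def)
  also have "\<dots> = (\<Sum>a\<in>\<Phi>. of_bool (fst a \<in> S \<and> snd a \<notin> S) - of_bool (fst a \<notin> S \<and> snd a \<in> S))"
    by (rule sum.cong) auto
  also have "\<dots> = int (card {(u, v) \<in> \<Phi>. u \<in> S \<and> v \<notin> S}) - int (card {(u, v) \<in> \<Phi>. u \<notin> S \<and> v \<in> S})"
    using assms by (simp add: sum_subtractf of_bool_def sum.If_cases Int_def case_prod_unfold)
  finally show ?thesis .
qed

text \<open>A directed cycle has divergence zero, so deleting it would leave a smaller arc set with
  the same divergence.\<close>

lemma acyclic_if_divergence_minimal:
  assumes "finite \<Phi>" and min: "\<And>\<Psi>. \<Psi> \<subset> \<Phi> \<Longrightarrow> divergence \<Psi> \<noteq> divergence \<Phi>"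
  shows "acyclic \<Phi>"
proof (rule acyclicI, intro allI notI)
  fix x assume "(x, x) \<in> \<Phi>\<^sup>+"
  then obtain y where y: "(x, y) \<in> \<Phi>" "(y, x) \<in> \<Phi>\<^sup>*" by (meson tranclD)
  obtain xs where xs: "xs \<noteq> []" "hd xs = y" "last xs = x" "distinct xs"
    "successively (\<lambda>u v. (u, v) \<in> \<Phi>) xs" using rtrancl_distinct_path[OF y(2)] .
  define C where "C = insert (x, y) (path_arcs xs)"
  have "(x, y) \<notin> path_arcs xs" using path_arcs_last[OF xs(4)] xs(3) by auto
  then have "divergence C v = of_bool (x = v) - of_bool (y = v) + divergence (path_arcs xs) v" for v
    by (simp add: C_def divergence_def)
  then have 0: "divergence C v = 0" for v
    using divergence_path[OF xs(1,4)] xs by auto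
  have C: "C \<subseteq> \<Phi>" "C \<noteq> {}" using path_arcs_subset[OF xs(5)] y by (auto simp: C_def)
  have "divergence \<Phi> v = divergence (\<Phi> - C) v" for v
    using divergence_split[OF assms(1), of v C] C 0 by (simp add: Int_absorb1)
  moreover have "\<Phi> - C \<subset> \<Phi>" using C by blast
  ultimately show False using min by (metis ext)
qed

lemma ex_acyclic_same_divergence:
  assumes "finite \<Phi>"
  shows "\<exists>\<Psi>\<subseteq>\<Phi>. acyclic \<Psi> \<and> divergence \<Psi> = divergence \<Phi>"
  using assms
proof (induction \<Phi> rule: finite_psubset_induct)
  case (psubset \<Phi>)
  show ?case
  proof (cases "\<exists>\<Psi>. \<Psi> \<subset> \<Phi> \<and> divergence \<Psi> = divergence \<Phi>")
    case True
    then show ?thesis using psubset.IH by (metis order.trans psubset_imp_subset)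
  next
    case False
    then show ?thesis using acyclic_if_divergence_minimal[OF psubset.hyps] by auto
  qed
qed

section \<open>Arcs of a graph, augmentation and flow across cuts\<close>

definition arcs :: "'v set set \<Rightarrow> ('v \<times> 'v) set" where
  "arcs E = {(u, v). {u, v} \<in> E}"

lemma arcs_simple_graph:
  assumes "simple_graph V E" "(u, v) \<in> arcs E"
  shows "u \<in> V" "v \<in> V" "u \<noteq> v" "(v, u) \<in> arcs E"
proof -
  have "{u, v} \<in> E" using assms(2) by (simp add: arcs_def)
  then have "{u, v} \<subseteq> V" "card {u, v} = 2" using assms(1) by (auto simp: simple_graph_def)
  then show "u \<in> V" "v \<in> V" "u \<noteq> v" by auto
  show "(v, u) \<in> arcs E" using \<open>{u, v} \<in> E\<close> by (simp add: arcs_def insert_commute)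
qed

lemma finite_arcs:
  assumes "simple_graph V E" shows "finite (arcs E)"
  by (rule finite_subset[of _ "V \<times> V"])
    (use assms arcs_simple_graph(1,2)[OF assms] in \<open>auto simp: simple_graph_def\<close>)

text \<open>Where the path runs against a flow arc, the two cancel instead of coexisting. The
  dropped parts of \<open>\<Phi>\<close> and \<open>P\<close> are converses of each other, so their
  divergences sum to zero.\<close>

lemma augment:
  assumes "finite \<Phi>" "xs \<noteq> []" "distinct xs" "path_arcs xs \<inter> \<Phi> = {}"
  defines "P \<equiv> path_arcs xs"
  shows "divergence ((\<Phi> - P\<inverse>) \<union> (P - \<Phi>\<inverse>)) v =
    divergence \<Phi> v + of_bool (v = hd xs) - of_bool (v = last xs)"
proof -
  have fin: "finite P" by (simp add: P_def)
  have "divergence ((\<Phi> - P\<inverse>) \<union> (P - \<Phi>\<inverse>)) v = divergence (\<Phi> - P\<inverse>) v + divergence (P - \<Phi>\<inverse>) v"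
    by (rule divergence_Un) (use assms fin in auto)
  moreover have "divergence \<Phi> v = divergence (\<Phi> - P\<inverse>) v + divergence (\<Phi> \<inter> P\<inverse>) v"
    by (rule divergence_split) fact
  moreover have "divergence P v = divergence (P - \<Phi>\<inverse>) v + divergence (P \<inter> \<Phi>\<inverse>) v"
    by (rule divergence_split) fact
  moreover have "P \<inter> \<Phi>\<inverse> = (\<Phi> \<inter> P\<inverse>)\<inverse>" by blast
  moreover have "divergence P v = of_bool (v = hd xs) - of_bool (v = last xs)"
    unfolding P_def by (rule divergence_path) fact+
  ultimately show ?thesis by (simp add: divergence_converse)
qed

text \<open>A 0/1 flow, encoded by its set of arcs. Acyclicity prevents flow in both directions of
  an edge and, later, closed walks along flow arcs alone.\<close>

definition flow_of_value :: "'v set set \<Rightarrow> 'v \<Rightarrow> 'v \<Rightarrow> nat \<Rightarrow> ('v \<times> 'v) set \<Rightarrow> bool" where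
  "flow_of_value E s r k \<Phi> \<longleftrightarrow> \<Phi> \<subseteq> arcs E \<and> acyclic \<Phi> \<and>
     (\<forall>v. divergence \<Phi> v = int k * (of_bool (v = s) - of_bool (v = r)))"

lemma acyclic_antiparallel: "acyclic \<Phi> \<Longrightarrow> (u, v) \<in> \<Phi> \<Longrightarrow> (v, u) \<notin> \<Phi>"
  by (meson acyclic_def trancl.simps)

lemma cut_edges_eq_image:
  assumes "simple_graph V E" "S \<subseteq> V"
  shows "cut_edges V E S = (\<lambda>(u, v). {u, v}) ` {(u, v) \<in> arcs E. u \<in> S \<and> v \<notin> S}"
  using arcs_simple_graph(2)[OF assms(1)] by (fastforce simp: cut_edges_def arcs_def)

text \<open>Allows the edges of a cut to be counted by their outward orientations.\<close>

lemma inj_on_crossing_arcs: "inj_on (\<lambda>(u, v). {u, v}) {(u, v). u \<in> S \<and> v \<notin> S}"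
  by (auto simp: inj_on_def doubleton_eq_iff)

lemma min_cut_size_le:
  assumes "simple_graph V E" "S \<subseteq> V" "s \<in> S" "r \<notin> S"
  shows "min_cut_size V E s r \<le> card (cut_edges V E S)"
  unfolding min_cut_size_def
proof (rule Min_le)
  show "finite (card ` separating_cuts V E s r)" using finite_separating_cuts[OF assms(1)] by simp
  show "card (cut_edges V E S) \<in> card ` separating_cuts V E s r"
    using assms by (auto simp: separating_cuts_def)
qed

text \<open>The divergence summed over \<open>S\<close> is \<open>k\<close>: \<open>s\<close>
  contributes \<open>k\<close>, and \<open>r\<close> lies outside.\<close>

lemma flow_across_cut:
  assumes G: "simple_graph V E" and \<Phi>: "flow_of_value E s r k \<Phi>"
    and S: "S \<subseteq> V" "s \<in> S" "r \<notin> S"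
  shows "card {(u, v) \<in> \<Phi>. u \<in> S \<and> v \<notin> S} = k + card {(u, v) \<in> \<Phi>. u \<notin> S \<and> v \<in> S}"
proof -
  have fS: "finite S" using G S finite_subset by (auto simp: simple_graph_def)
  have f\<Phi>: "finite \<Phi>" using \<Phi> finite_arcs[OF G] finite_subset by (auto simp: flow_of_value_def)
  have "(\<Sum>v\<in>S. divergence \<Phi> v) = (\<Sum>v\<in>S. int k * of_bool (v = s))"
    using \<Phi> S by (intro sum.cong) (auto simp: flow_of_value_def)
  also have "\<dots> = int k" using S fS by (simp add: of_bool_def if_distrib[where f = "\<lambda>x. int k * x"] cong: if_cong)
  finally show ?thesis using sum_divergence[OF fS f\<Phi>] by linarith
qed

text \<open>Max-flow min-cut for unit capacities, by augmenting paths.\<close>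

lemma ex_flow_of_value:
  assumes G: "simple_graph V E" and "s \<in> V" "s \<noteq> r" and "k \<le> min_cut_size V E s r"
  shows "\<exists>\<Phi>. flow_of_value E s r k \<Phi>"
  using assms(4)
proof (induction k)
  case 0
  show ?case by (rule exI[of _ "{}"]) (auto simp: flow_of_value_def divergence_def acyclic_def)
next
  case (Suc k)
  then obtain \<Phi> where \<Phi>: "flow_of_value E s r k \<Phi>" by auto
  have f\<Phi>: "finite \<Phi>" using \<Phi> finite_arcs[OF G] finite_subset by (auto simp: flow_of_value_def)
  \<comment> \<open>Reachability in the residual graph: the reverse of a flow arc is never in the
    acyclic flow, so it stays available.\<close>
  define R where "R = {v. (s, v) \<in> (arcs E - \<Phi>)\<^sup>*}"
  have RV: "R \<subseteq> V"
  proof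
    fix v assume "v \<in> R"
    then have "(s, v) \<in> (arcs E - \<Phi>)\<^sup>*" by (simp add: R_def)
    then show "v \<in> V" by (induction rule: rtrancl_induct) (use assms arcs_simple_graph in auto)
  qed
  have "r \<in> R"
  proof (rule ccontr)
    assume r: "r \<notin> R"
    have sR: "s \<in> R" by (simp add: R_def)
    have out: "(u, v) \<in> \<Phi>" if "(u, v) \<in> arcs E" "u \<in> R" "v \<notin> R" for u v
      using that by (auto simp: R_def dest: rtrancl.rtrancl_into_rtrancl)
    have *: "{(u, v) \<in> arcs E. u \<in> R \<and> v \<notin> R} = {(u, v) \<in> \<Phi>. u \<in> R \<and> v \<notin> R}"
      using out \<Phi> by (auto simp: flow_of_value_def)
    \<comment> \<open>The reverse of such an arc would leave \<open>R\<close> and hence be in the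
      flow, against acyclicity.\<close>
    have "\<not> (u \<notin> R \<and> v \<in> R)" if uv: "(u, v) \<in> \<Phi>" for u v
    proof
      assume "u \<notin> R \<and> v \<in> R"
      moreover have "(u, v) \<in> arcs E" "acyclic \<Phi>" using \<Phi> uv by (auto simp: flow_of_value_def)
      ultimately have "(v, u) \<in> \<Phi>" using out[of v u] arcs_simple_graph(4)[OF G] by simp
      then show False using acyclic_antiparallel[OF \<open>acyclic \<Phi>\<close> uv] by simp
    qed
    then have empty: "{(u, v) \<in> \<Phi>. u \<notin> R \<and> v \<in> R} = {}" by blast
    have "card {(u, v) \<in> \<Phi>. u \<in> R \<and> v \<notin> R} = k"
      using flow_across_cut[OF G \<Phi> RV sR r] unfolding empty by simp
    moreover have "card (cut_edges V E R) = card {(u, v) \<in> arcs E. u \<in> R \<and> v \<notin> R}"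
      unfolding cut_edges_eq_image[OF G RV]
      by (rule card_image) (rule inj_on_subset[OF inj_on_crossing_arcs], auto)
    ultimately show False using min_cut_size_le[OF G RV sR r] Suc.prems * by simp
  qed
  then have "(s, r) \<in> (arcs E - \<Phi>)\<^sup>*" by (simp add: R_def)
  then obtain xs where xs: "xs \<noteq> []" "hd xs = s" "last xs = r" "distinct xs"
    "successively (\<lambda>u v. (u, v) \<in> arcs E - \<Phi>) xs"
    using rtrancl_distinct_path by metis
  define P where "P = path_arcs xs"
  have P: "P \<subseteq> arcs E - \<Phi>" unfolding P_def using path_arcs_subset[OF xs(5)] .
  define \<Psi> where "\<Psi> = (\<Phi> - P\<inverse>) \<union> (P - \<Phi>\<inverse>)"
  have "divergence \<Psi> v = divergence \<Phi> v + of_bool (v = hd xs) - of_bool (v = last xs)" for v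
    unfolding \<Psi>_def P_def by (rule augment) (use f\<Phi> xs P P_def in auto)
  moreover have "divergence \<Phi> v = int k * (of_bool (v = s) - of_bool (v = r))" for v
    using \<Phi> by (simp add: flow_of_value_def)
  ultimately have div: "divergence \<Psi> v = int (Suc k) * (of_bool (v = s) - of_bool (v = r))" for v
    by (simp only: xs(2,3)) (simp add: algebra_simps)
  have \<Psi>: "\<Psi> \<subseteq> arcs E" using P \<Phi> by (auto simp: \<Psi>_def flow_of_value_def)
  then have "finite \<Psi>" using finite_arcs[OF G] finite_subset by auto
  \<comment> \<open>Augmenting may create directed cycles; they are discarded.\<close>
  then obtain \<Psi>' where "\<Psi>' \<subseteq> \<Psi>" "acyclic \<Psi>'" "divergence \<Psi>' = divergence \<Psi>"
    using ex_acyclic_same_divergence by blast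
  then show ?case using \<Psi> div unfolding flow_of_value_def by (intro exI[of _ \<Psi>']) auto
qed

section \<open>A resilient finite protocol\<close>

locale flow_protocol =
  fixes V :: "'v set" and E :: "'v set set" and s r :: 'v and \<Phi> :: "('v \<times> 'v) set"
    and rank :: "'v set \<Rightarrow> nat" and k :: nat
  assumes G: "simple_graph V E" and sV: "s \<in> V" and sr: "s \<noteq> r"
    and flow: "flow_of_value E s r k \<Phi>" and rank: "inj_on rank E"
begin

definition idle_arcs :: "('v \<times> 'v) set" where
  "idle_arcs = {(u, v) \<in> arcs E. (u, v) \<notin> \<Phi> \<and> (v, u) \<notin> \<Phi>}"

text \<open>For \<open>S \<subseteq> V\<close> containing \<open>s\<close> but not \<open>r\<close>,
  this means that exactly \<open>k\<close> flow arcs leave \<open>S\<close>, the least possible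
  number.\<close>

definition closed_cut :: "'v set \<Rightarrow> bool" where
  "closed_cut S \<longleftrightarrow> (\<forall>(u, v) \<in> \<Phi>. v \<in> S \<longrightarrow> u \<in> S)"

definition first_crossing :: "'v set \<Rightarrow> 'v \<Rightarrow> 'v \<Rightarrow> bool" where
  "first_crossing S x y \<longleftrightarrow> (x, y) \<in> idle_arcs \<and> x \<in> S \<and> y \<notin> S \<and>
     (\<forall>(u, v) \<in> idle_arcs. u \<in> S \<and> v \<notin> S \<longrightarrow> rank {x, y} \<le> rank {u, v})"

text \<open>As \<open>rank\<close> is injective on edges, each \<open>S\<close> adds at most one
  arc: few enough to exclude closed walks without turns back, yet one for every closed set that an
  idle arc leaves.\<close>

definition used_arcs :: "('v \<times> 'v) set" where
  "used_arcs = \<Phi> \<union> {(x, y). \<exists>S. closed_cut S \<and> first_crossing S x y}"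

definition protocol :: "('v \<times> 'v \<times> 'v) set" where
  "protocol = {(u, v, w). (u, v) \<in> used_arcs \<and> (v, w) \<in> used_arcs \<and> u \<noteq> w}"

lemma idle_sym: "(u, v) \<in> idle_arcs \<longleftrightarrow> (v, u) \<in> idle_arcs"
  using arcs_simple_graph(4)[OF G] by (auto simp: idle_arcs_def)

lemma used_arcs_subset: "used_arcs \<subseteq> arcs E"
  using flow by (auto simp: used_arcs_def first_crossing_def idle_arcs_def flow_of_value_def)

lemma ex_first_crossing:
  assumes "(u, v) \<in> idle_arcs" "u \<in> S" "v \<notin> S"
  shows "\<exists>x y. first_crossing S x y"
proof -
  let ?P = "\<lambda>a. a \<in> idle_arcs \<and> fst a \<in> S \<and> snd a \<notin> S"
  let ?f = "\<lambda>a. rank {fst a, snd a}"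
  have "?P (arg_min ?f ?P) \<and> (\<forall>a. ?P a \<longrightarrow> ?f (arg_min ?f ?P) \<le> ?f a)"
    by (rule arg_min_nat_lemma[of ?P "(u, v)"]) (use assms in auto)
  then show ?thesis
    by (intro exI[of _ "fst (arg_min ?f ?P)"] exI[of _ "snd (arg_min ?f ?P)"])
      (auto simp: first_crossing_def)
qed

lemma ex_entry:
  fixes f :: "nat \<Rightarrow> 'v"
  assumes "a \<le> b" "f a \<notin> S" "f b \<in> S"
  shows "\<exists>j\<ge>a. j < b \<and> f j \<notin> S \<and> f (Suc j) \<in> S"
  using assms
proof (induction b rule: dec_induct)
  case (step n)
  then show ?case by (cases "f n \<in> S") (auto simp: less_Suc_eq)
qed auto

text \<open>Among the arcs outside the flow on a closed walk, take one of maximal rank, with its cut \<open>S\<close>.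
  The walk re-enters \<open>S\<close>, which by maximality it can only do through the same edge; between
  the two opposite traversals of that edge there is a shorter closed walk.\<close>

lemma no_closed_walk:
  fixes f :: "nat \<Rightarrow> 'v"
  assumes "a < b" "f a = f b"
    and "\<And>i. a \<le> i \<Longrightarrow> i < b \<Longrightarrow> (f i, f (Suc i)) \<in> used_arcs"
    and "\<And>i. a \<le> i \<Longrightarrow> i + 2 \<le> b \<Longrightarrow> f i \<noteq> f (i + 2)"
  shows False
  using assms
proof (induction "b - a" arbitrary: a b rule: less_induct)
  case less
  note arc = less.prems(3) and nb = less.prems(4)
  define I where "I = {i. a \<le> i \<and> i < b \<and> (f i, f (Suc i)) \<notin> \<Phi>}"
  have fI: "finite I" by (rule finite_subset[of _ "{..<b}"]) (auto simp: I_def)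
  \<comment> \<open>A closed walk of flow arcs alone would contradict acyclicity of
    \<open>\<Phi>\<close>.\<close>
  have "I \<noteq> {}"
  proof
    assume "I = {}"
    then have \<Phi>: "(f i, f (Suc i)) \<in> \<Phi>" if "a \<le> i" "i < b" for i using that by (auto simp: I_def)
    have "(f a, f n) \<in> \<Phi>\<^sup>+" if "Suc a \<le> n" "n \<le> b" for n
      using that
    proof (induction n rule: dec_induct)
      case base
      then show ?case using \<Phi> by auto
    next
      case (step n)
      then show ?case using \<Phi>[of n] by (auto intro: trancl_into_trancl)
    qed
    from this[of b] show False using less.prems(1,2) flow by (auto simp: flow_of_value_def acyclic_def)
  qed
  define g where "g i = rank {f i, f (Suc i)}" for i
  obtain i where i: "i \<in> I" "\<And>j. j \<in> I \<Longrightarrow> g j \<le> g i"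
    using Max_in[of "g ` I"] Max_ge[of "g ` I"] fI \<open>I \<noteq> {}\<close> by (smt (verit) finite_imageI image_iff image_is_empty)
  have iab: "a \<le> i" "i < b" using i by (auto simp: I_def)
  then have "(f i, f (Suc i)) \<in> used_arcs - \<Phi>" using arc i(1) by (auto simp: I_def)
  then obtain S where S: "closed_cut S" "first_crossing S (f i) (f (Suc i))"
    by (auto simp: used_arcs_def)
  then have iS: "f i \<in> S" "f (Suc i) \<notin> S" by (auto simp: first_crossing_def)
  \<comment> \<open>Step \<open>i\<close> leaves \<open>S\<close>. As the walk is closed, it enters
    \<open>S\<close> after \<open>i\<close> or, if its common end point lies outside
    \<open>S\<close>, before \<open>i\<close>.\<close>
  have "\<exists>j\<ge>a. j < b \<and> f j \<notin> S \<and> f (Suc j) \<in> S"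
  proof (cases "f b \<in> S")
    case True
    then obtain j where "j \<ge> Suc i" "j < b" "f j \<notin> S" "f (Suc j) \<in> S"
      using ex_entry[of "Suc i" b f S] iab iS by auto
    then show ?thesis using iab by (intro exI[of _ j]) auto
  next
    case False
    then obtain j where "j \<ge> a" "j < i" "f j \<notin> S" "f (Suc j) \<in> S"
      using ex_entry[of a i f S] iab iS less.prems(2) by auto
    then show ?thesis using iab by (intro exI[of _ j]) auto
  qed
  then obtain j where j: "a \<le> j" "j < b" "f j \<notin> S" "f (Suc j) \<in> S" by blast
  \<comment> \<open>No flow arc enters \<open>S\<close>, so step \<open>j\<close> is idle; its
    reverse leaves \<open>S\<close> and thus has rank at least that of step
    \<open>i\<close>.\<close>
  have j\<Phi>: "(f j, f (Suc j)) \<notin> \<Phi>" using j S(1) by (auto simp: closed_cut_def)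
  then have jI: "j \<in> I" using j by (simp add: I_def)
  have "(f j, f (Suc j)) \<in> used_arcs - \<Phi>" using arc j j\<Phi> by auto
  then have "(f j, f (Suc j)) \<in> idle_arcs" by (auto simp: used_arcs_def first_crossing_def)
  then have idle: "(f (Suc j), f j) \<in> idle_arcs" using idle_sym by blast
  then have "g i \<le> g j" using S(2) j unfolding first_crossing_def g_def by (fastforce simp: insert_commute)
  then have "g i = g j" using i(2)[OF jI] by simp
  moreover have "{f i, f (Suc i)} \<in> E" "{f j, f (Suc j)} \<in> E"
    using arc iab j used_arcs_subset by (auto simp: arcs_def)
  ultimately have "{f i, f (Suc i)} = {f j, f (Suc j)}" using rank by (auto simp: g_def inj_on_def)
  then have eq: "f j = f (Suc i)" "f (Suc j) = f i" using iS j by (auto simp: doubleton_eq_iff)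
  have "i \<noteq> j" using iS j by auto
  \<comment> \<open>Adjacent traversals would be a turn back. Otherwise a shorter closed walk lies
    between them; nothing is demanded at its closing point, so it inherits the condition against
    turning back.\<close>
  then consider "i < j" | "j < i" by linarith
  then show False
  proof cases
    case 1
    have "j \<noteq> Suc i" using nb[of i] iab j eq by auto
    with 1 have "Suc i < j" by simp
    then show False
      by (rule less.hyps[of j "Suc i", rotated]) (use 1 iab j eq arc nb in auto)
  next
    case 2
    have "i \<noteq> Suc j" using nb[of j] iab j eq by auto
    with 2 have "Suc j < i" by simp
    then show False
      by (rule less.hyps[of i "Suc j", rotated]) (use 2 iab j eq arc nb in auto)
  qed
qed

section \<open>Finiteness of the protocol and its surviving walks\<close>

lemma protocol_walk_distinct:
  assumes "xs \<in> protocol_walks E s r protocol"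
  shows "distinct xs"
\<comment> \<open>Walks with at most two vertices contain no triple, so the protocol does not
  constrain their arcs.\<close>
proof (cases "length xs \<le> 2")
  case True
  then show ?thesis using assms sr
    by (cases xs; cases "tl xs") (auto simp: protocol_walks_def walk_def)
next
  case False
  have tri: "(xs ! i, xs ! (i + 1), xs ! (i + 2)) \<in> protocol" if "i + 2 < length xs" for i
    using assms that by (auto simp: protocol_walks_def)
  have arc: "(xs ! i, xs ! Suc i) \<in> used_arcs" if "Suc i < length xs" for i
  proof (cases "i + 2 < length xs")
    case True
    then show ?thesis using tri[of i] by (simp add: protocol_def)
  next
    \<comment> \<open>The last arc starts no triple; it ends the preceding one.\<close>
    case F: False
    then obtain j where "i = Suc j" using False that by (cases i) auto
    then show ?thesis using tri[of j] that by (simp add: protocol_def)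
  qed
  \<comment> \<open>A repeated vertex would bound a closed walk without turns back.\<close>
  have "xs ! a \<noteq> xs ! b" if "a < b" "b < length xs" for a b
    using no_closed_walk[of a b "\<lambda>i. xs ! i"] that arc tri by (fastforce simp: protocol_def)
  then show ?thesis by (metis distinct_conv_nth linorder_neqE_nat)
qed

lemma walk_vertices:
  assumes "walk E s r xs" shows "set xs \<subseteq> V"
proof
  fix x assume "x \<in> set xs"
  then obtain i where i: "i < length xs" "x = xs ! i" by (metis in_set_conv_nth)
  show "x \<in> V"
  proof (cases i)
    case 0
    then show ?thesis using assms i sV by (auto simp: walk_def hd_conv_nth)
  next
    case (Suc j)
    then have "{xs ! j, xs ! i} \<in> E" using assms i by (auto simp: walk_def)
    then show ?thesis using G i by (auto simp: simple_graph_def)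
  qed
qed

lemma finite_protocol_protocol: "finite_protocol E s r protocol"
proof -
  have "protocol \<subseteq> instructions E"
    using used_arcs_subset by (auto simp: protocol_def instructions_def arcs_def)
  moreover have "protocol_walks E s r protocol \<subseteq> {xs. distinct xs \<and> set xs \<subseteq> V}"
    using protocol_walk_distinct walk_vertices by (auto simp: protocol_walks_def)
  moreover have "finite {xs. distinct xs \<and> set xs \<subseteq> V}"
    using G finite_subset_distinct[of V] by (simp add: simple_graph_def conj_commute)
  ultimately show ?thesis using finite_subset by (auto simp: finite_protocol_def)
qed

lemma ex_surviving_walk:
  assumes F: "F \<subseteq> E" "card F \<le> k" "F \<notin> separating_cuts V E s r"
  shows "\<exists>xs\<in>protocol_walks E s r protocol. walk_edges xs \<inter> F = {}"
proof -
  define D where "D = {(u, v) \<in> used_arcs. {u, v} \<notin> F}"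
  define R where "R = {v. (s, v) \<in> D\<^sup>*}"
  have D: "D \<subseteq> arcs E" using used_arcs_subset by (auto simp: D_def)
  have RV: "R \<subseteq> V"
  proof
    fix v assume "v \<in> R"
    then have "(s, v) \<in> D\<^sup>*" by (simp add: R_def)
    then show "v \<in> V"
      by (induction rule: rtrancl_induct) (use sV D arcs_simple_graph(2)[OF G] in auto)
  qed
  have sR: "s \<in> R" by (simp add: R_def)
  have out: "{u, v} \<in> F" if "(u, v) \<in> used_arcs" "u \<in> R" "v \<notin> R" for u v
    using that by (auto simp: R_def D_def dest: rtrancl.rtrancl_into_rtrancl)
  have "r \<in> R"
  proof (rule ccontr)
    assume r: "r \<notin> R"
    have fF: "finite F" using F(1) finite_edges[OF G] finite_subset by auto
    have f\<Phi>: "finite \<Phi>" using flow finite_arcs[OF G] finite_subset by (auto simp: flow_of_value_def)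
    define W where "W = {(u, v) \<in> \<Phi>. u \<in> R \<and> v \<notin> R}"
    define W' where "W' = (\<lambda>(u, v). {u, v}) ` W"
    have W'F: "W' \<subseteq> F" using out by (auto simp: W'_def W_def used_arcs_def)
    have card: "card W' = card W"
      unfolding W'_def
      by (rule card_image) (rule inj_on_subset[OF inj_on_crossing_arcs], auto simp: W_def)
    \<comment> \<open>At least \<open>k\<close> flow edges leave \<open>R\<close>, all of them
      failed, and at most \<open>k\<close> edges failed. Equality holds throughout: \<open>F\<close>
      consists of these edges, and no flow arc enters \<open>R\<close>.\<close>
    have cW: "card W = k + card {(u, v) \<in> \<Phi>. u \<notin> R \<and> v \<in> R}"
      unfolding W_def by (rule flow_across_cut[OF G flow RV sR r])
    have le: "card W' \<le> card F" by (rule card_mono) fact+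
    then have "W' = F" using card_subset_eq[OF fF W'F] card cW F(2) by linarith
    have "card {(u, v) \<in> \<Phi>. u \<notin> R \<and> v \<in> R} = 0" using le card cW F(2) by linarith
    moreover have "finite {(u, v) \<in> \<Phi>. u \<notin> R \<and> v \<in> R}" by (rule finite_subset[OF _ f\<Phi>]) auto
    ultimately have closed: "closed_cut R" by (auto simp: closed_cut_def)
    have "cut_edges V E R \<noteq> F" using F(3) RV sR r by (auto simp: separating_cuts_def)
    moreover have "F \<subseteq> cut_edges V E R"
      using flow unfolding \<open>W' = F\<close>[symmetric] cut_edges_eq_image[OF G RV]
      by (auto simp: W'_def W_def flow_of_value_def)
    ultimately obtain u v where uv: "(u, v) \<in> arcs E" "u \<in> R" "v \<notin> R" "{u, v} \<notin> F"
      unfolding cut_edges_eq_image[OF G RV] by auto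
    have "(u, v) \<notin> \<Phi>" using uv out by (auto simp: used_arcs_def)
    moreover have "(v, u) \<notin> \<Phi>" using closed uv by (auto simp: closed_cut_def)
    ultimately have "(u, v) \<in> idle_arcs" using uv by (simp add: idle_arcs_def)
    then obtain x y where xy: "first_crossing R x y" using ex_first_crossing uv by blast
    then have "(x, y) \<in> used_arcs" "x \<in> R" "y \<notin> R" using closed
      by (auto simp: used_arcs_def first_crossing_def)
    then have "{x, y} \<in> W'" using out \<open>W' = F\<close> by auto
    \<comment> \<open>Every failed edge carries flow, whereas \<open>(x, y)\<close> is idle.\<close>
    then show False using xy
      by (auto simp: W'_def W_def first_crossing_def idle_arcs_def doubleton_eq_iff)
  qed
  then have "(s, r) \<in> D\<^sup>*" by (simp add: R_def)
  then obtain xs where xs: "xs \<noteq> []" "hd xs = s" "last xs = r" "distinct xs"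
    "successively (\<lambda>u v. (u, v) \<in> D) xs"
    using rtrancl_distinct_path by metis
  have step: "(xs ! i, xs ! Suc i) \<in> D" if "Suc i < length xs" for i
    using xs(5) that by (simp add: successively_conv_nth)
  have "walk E s r xs" using xs step D by (auto simp: walk_def arcs_def)
  \<comment> \<open>Distinctness of the path rules out turning back.\<close>
  moreover have "(xs ! i, xs ! (i + 1), xs ! (i + 2)) \<in> protocol" if "i + 2 < length xs" for i
    using step[of i] step[of "Suc i"] that xs(4) by (auto simp: protocol_def D_def nth_eq_iff_index_eq)
  ultimately have "xs \<in> protocol_walks E s r protocol" by (simp add: protocol_walks_def)
  moreover have "walk_edges xs \<inter> F = {}" using step by (auto simp: walk_edges_def D_def)
  ultimately show ?thesis by blast
qed

end

lemma ex_resilient_protocol: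
  assumes "simple_graph V E" "s \<in> V" "s \<noteq> r"
  obtains A where "finite_protocol E s r A"
    "\<And>F. F \<subseteq> E \<Longrightarrow> card F \<le> min_cut_size V E s r \<Longrightarrow> F \<notin> separating_cuts V E s r \<Longrightarrow>
      \<exists>xs\<in>protocol_walks E s r A. walk_edges xs \<inter> F = {}"
proof -
  obtain \<Phi> where "flow_of_value E s r (min_cut_size V E s r) \<Phi>"
    using ex_flow_of_value[OF assms] by blast
  moreover obtain rank :: "'a set \<Rightarrow> nat" where "inj_on rank E"
    using finite_imp_inj_to_nat_seg[OF finite_edges[OF assms(1)]] by blast
  ultimately interpret flow_protocol V E s r \<Phi> rank "min_cut_size V E s r"
    using assms by unfold_locales
  show thesis using that finite_protocol_protocol ex_surviving_walk by blast
qed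

section \<open>Reliability polynomials\<close>

text \<open>An outcome in the support is \<open>False\<close> outside \<open>E\<close>, so it is
  determined by its set \<open>F\<close> of failed edges, over which the sum runs.\<close>

lemma prob_survival_pmf:
  fixes p :: real
  assumes "finite E" "0 \<le> p" "p \<le> 1"
  shows "measure_pmf.prob (survival_pmf E p) {\<omega>. P \<omega>} =
    (\<Sum>F | F \<subseteq> E \<and> P (\<lambda>x. x \<in> E - F). (1 - p) ^ card F * p ^ (card E - card F))"
proof -
  define M where "M = survival_pmf E p"
  define g :: "'a set set \<Rightarrow> 'a set \<Rightarrow> bool" where "g F = (\<lambda>x. x \<in> E - F)" for F
  have inj: "inj_on g (Pow E)"
  proof (rule inj_onI)
    fix F F' assume "F \<in> Pow E" "F' \<in> Pow E" "g F = g F'"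
    then have "E - F = E - F'" by (auto simp: g_def fun_eq_iff)
    with \<open>F \<in> Pow E\<close> \<open>F' \<in> Pow E\<close> show "F = F'" by blast
  qed
  have supp: "\<omega> \<in> g ` Pow E" if "\<omega> \<in> set_pmf M" for \<omega>
  proof -
    have "\<not> \<omega> x" if "x \<notin> E" for x
      using \<open>\<omega> \<in> set_pmf M\<close> that set_Pi_pmf_subset[OF assms(1)]
      unfolding M_def survival_pmf_def by fastforce
    then have "\<omega> = g {x \<in> E. \<not> \<omega> x}" by (auto simp: g_def fun_eq_iff)
    then show ?thesis by blast
  qed
  have pmf: "pmf M (g F) = (1 - p) ^ card F * p ^ (card E - card F)" if "F \<subseteq> E" for F
  proof -
    have "pmf M (g F) = (\<Prod>x\<in>E. pmf (bernoulli_pmf p) (g F x))"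
      unfolding M_def survival_pmf_def by (subst pmf_Pi) (use assms in \<open>auto simp: g_def\<close>)
    also have "\<dots> = (\<Prod>x\<in>E. if x \<in> F then 1 - p else p)"
      by (rule prod.cong) (use assms that in \<open>auto simp: g_def\<close>)
    also have "\<dots> = (1 - p) ^ card (E \<inter> F) * p ^ card (E - F)"
      using assms by (simp add: prod.If_cases Diff_eq)
    finally show ?thesis
      using that assms by (simp add: Int_absorb1 card_Diff_subset finite_subset)
  qed
  have "measure_pmf.prob M {\<omega>. P \<omega>} = measure_pmf.prob M (g ` {F. F \<subseteq> E \<and> P (g F)})"
    by (subst (1 2) measure_Int_set_pmf[symmetric]) (rule arg_cong2[where f = measure], use supp in auto)
  also have "\<dots> = sum (pmf M) (g ` {F. F \<subseteq> E \<and> P (g F)})"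
    by (rule measure_measure_pmf_finite) (use assms in simp)
  also have "\<dots> = (\<Sum>F | F \<subseteq> E \<and> P (g F). pmf M (g F))"
    by (subst sum.reindex) (auto intro: inj_on_subset[OF inj])
  also have "\<dots> = (\<Sum>F | F \<subseteq> E \<and> P (g F). (1 - p) ^ card F * p ^ (card E - card F))"
    by (rule sum.cong) (auto simp: pmf)
  finally show ?thesis by (simp add: M_def g_def)
qed

definition survives :: "'v set set \<Rightarrow> 'v \<Rightarrow> 'v \<Rightarrow> ('v \<times> 'v \<times> 'v) set \<Rightarrow> 'v set set \<Rightarrow> bool" where
  "survives E s r A F \<longleftrightarrow> (\<exists>xs\<in>protocol_walks E s r A. walk_edges xs \<inter> F = {})"

lemma walk_edges_subset: "xs \<in> protocol_walks E s r A \<Longrightarrow> walk_edges xs \<subseteq> E"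
  by (auto simp: protocol_walks_def walk_def walk_edges_def)

lemma survives_iff:
  "(\<exists>xs\<in>protocol_walks E s r A. \<forall>e\<in>walk_edges xs. e \<in> E - F) \<longleftrightarrow> survives E s r A F"
  unfolding survives_def using walk_edges_subset by (fastforce intro!: bex_cong)

lemma rho_eq_sum:
  assumes "finite E" "0 \<le> p" "p \<le> 1"
  shows "rho E s r A p =
    (\<Sum>F | F \<subseteq> E \<and> survives E s r A F. (1 - p) ^ card F * p ^ (card E - card F))"
  unfolding rho_def by (subst prob_survival_pmf[OF assms]) (simp only: survives_iff)

lemma one_minus_rho_eq_sum:
  assumes "finite E" "0 \<le> p" "p \<le> 1"
  shows "1 - rho E s r A p =
    (\<Sum>F | F \<subseteq> E \<and> \<not> survives E s r A F. (1 - p) ^ card F * p ^ (card E - card F))"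
proof -
  have "1 - rho E s r A p = measure_pmf.prob (survival_pmf E p)
       {\<omega>. \<not> (\<exists>xs\<in>protocol_walks E s r A. \<forall>e\<in>walk_edges xs. \<omega> e)}"
    unfolding rho_def by (subst measure_pmf.prob_compl[symmetric]) (auto intro!: arg_cong2[where f = measure])
  then show ?thesis by (subst (asm) prob_survival_pmf[OF assms]) (simp only: survives_iff)
qed

section \<open>Bernstein form of the reliability and its sign for small \<open>q\<close>\<close>

lemma rho_bernstein:
  assumes "finite E" "0 \<le> p" "p \<le> 1"
  shows "rho E s r A p = (\<Sum>k\<le>card E. real (card {F. F \<subseteq> E \<and> survives E s r A F \<and> card F = k}) *
    ((1 - p) ^ k * p ^ (card E - k)))"
proof -
  let ?X = "{F. F \<subseteq> E \<and> survives E s r A F}"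
  \<comment> \<open>Grouping the failure sets by size yields integer coefficients.\<close>
  have "rho E s r A p = (\<Sum>k\<le>card E. \<Sum>F | F \<in> ?X \<and> card F = k. (1 - p) ^ card F * p ^ (card E - card F))"
    unfolding rho_eq_sum[OF assms]
    by (rule sum.group[symmetric]) (use assms in \<open>auto intro: card_mono\<close>)
  also have "\<dots> = (\<Sum>k\<le>card E. \<Sum>F | F \<in> ?X \<and> card F = k. (1 - p) ^ k * p ^ (card E - k))"
    by (intro sum.cong refl) auto
  finally show ?thesis by (simp add: conj_assoc)
qed

text \<open>The first nonzero coefficient, a positive integer, is at least 1. If
  \<open>k0 < m\<close>, the later terms sum to at most
  \<open>2 ^ m * q ^ (k0 + 1) * (1 - q) ^ (m - k0 - 1)\<close>, which is below the first term as
  soon as \<open>(2 ^ m + 1) * q < 1\<close>.\<close>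

lemma bernstein_pos:
  fixes d :: "nat \<Rightarrow> int" and q :: real
  assumes d: "\<And>k. k \<le> m \<Longrightarrow> \<bar>d k\<bar> \<le> int (m choose k)"
    and k0: "k0 \<le> m" "d k0 > 0" "\<And>k. k < k0 \<Longrightarrow> d k = 0"
    and q: "0 < q" "q < 1" "q < 1 / 3 ^ m"
  shows "(\<Sum>k\<le>m. d k * (q ^ k * (1 - q) ^ (m - k))) > 0"
proof -
  let ?f = "\<lambda>k. d k * (q ^ k * (1 - q) ^ (m - k))"
  have split: "(\<Sum>k\<le>m. ?f k) = ?f k0 + (\<Sum>k\<in>{k0<..m}. ?f k)"
  proof -
    have "(\<Sum>k\<le>m. ?f k) = (\<Sum>k\<in>{k0..m}. ?f k)"
      by (rule sum.mono_neutral_right) (use k0 in auto)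
    also have "\<dots> = ?f k0 + (\<Sum>k\<in>{k0<..m}. ?f k)" by (rule sum.head) fact
    finally show ?thesis .
  qed
  have lead: "q ^ k0 * (1 - q) ^ (m - k0) \<le> ?f k0" using k0(2) q by simp
  show ?thesis
  proof (cases "k0 = m")
    case True
    have "0 < q ^ k0 * (1 - q) ^ (m - k0)" using q by simp
    then show ?thesis using split lead True by simp
  next
    case False
    define n where "n = m - Suc k0"
    have mk: "m - k0 = Suc n" using False k0(1) by (simp add: n_def)
    have "(3::real) ^ 1 \<le> 3 ^ m" using False k0(1) by (intro power_increasing) auto
    then have "1 / 3 ^ m \<le> (1 / 3 :: real)" by (intro divide_left_mono) auto
    then have qp: "q \<le> 1 - q" using q by linarith
    \<comment> \<open>Every factor \<open>q\<close> beyond the first \<open>k0 + 1\<close> is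
      bounded by \<open>1 - q\<close>.\<close>
    have tail: "\<bar>?f k\<bar> \<le> real (m choose k) * (q ^ Suc k0 * (1 - q) ^ n)" if k: "k \<in> {k0<..m}" for k
    proof -
      have "q ^ k * (1 - q) ^ (m - k) = q ^ Suc k0 * (q ^ (k - Suc k0) * (1 - q) ^ (m - k))"
        using k by (simp flip: power_add power_Suc mult.assoc)
      also have "\<dots> \<le> q ^ Suc k0 * ((1 - q) ^ (k - Suc k0) * (1 - q) ^ (m - k))"
        using q qp by (intro mult_left_mono mult_right_mono power_mono) auto
      also have "(1 - q) ^ (k - Suc k0) * (1 - q) ^ (m - k) = (1 - q) ^ n"
        using k by (simp add: n_def flip: power_add)
      finally have mono: "q ^ k * (1 - q) ^ (m - k) \<le> q ^ Suc k0 * (1 - q) ^ n" .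
      have coeff: "\<bar>real_of_int (d k)\<bar> \<le> real (m choose k)"
        using d[of k] k by (metis greaterThanAtMost_iff of_int_abs of_int_le_iff of_int_of_nat_eq)
      have "\<bar>real_of_int (d k)\<bar> * (q ^ k * (1 - q) ^ (m - k)) \<le>
          real (m choose k) * (q ^ Suc k0 * (1 - q) ^ n)"
        by (rule mult_mono[OF coeff mono]) (use q in auto)
      moreover have "\<bar>?f k\<bar> = \<bar>real_of_int (d k)\<bar> * (q ^ k * (1 - q) ^ (m - k))"
        using q by (simp add: abs_mult)
      ultimately show ?thesis by simp
    qed
    have "\<bar>\<Sum>k\<in>{k0<..m}. ?f k\<bar> \<le> (\<Sum>k\<in>{k0<..m}. real (m choose k) * (q ^ Suc k0 * (1 - q) ^ n))"
      by (rule order.trans[OF sum_abs sum_mono]) (rule tail)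
    also have "\<dots> \<le> (\<Sum>k\<le>m. real (m choose k) * (q ^ Suc k0 * (1 - q) ^ n))"
      by (rule sum_mono2) (use q in auto)
    also have "\<dots> = real (\<Sum>k\<le>m. m choose k) * (q ^ Suc k0 * (1 - q) ^ n)"
      by (simp add: sum_distrib_right)
    also have "\<dots> = (2 ^ m * q) * (q ^ k0 * (1 - q) ^ n)"
      by (simp add: choose_row_sum)
    also have "\<dots> < (1 - q) * (q ^ k0 * (1 - q) ^ n)"
    proof (rule mult_strict_right_mono)
      \<comment> \<open>The source of the threshold \<open>1 / 3 ^ m\<close>; the inequality
        requires \<open>m > 0\<close>, which follows from \<open>k0 < m\<close>.\<close>
      have "(2::real) ^ m + 1 \<le> 3 ^ m"
      proof -
        obtain l where "m = Suc l" using False k0(1) by (cases m) auto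
        moreover have "(2::real) ^ l \<le> 3 ^ l" "(1::real) \<le> 3 ^ l" by (simp_all add: power_mono)
        ultimately show ?thesis by (simp only: power_Suc)
      qed
      then have "(2 ^ m + 1) * q \<le> 3 ^ m * q" using q by (intro mult_right_mono) auto
      also have "\<dots> < 1" using q by (simp add: field_simps)
      finally show "2 ^ m * q < 1 - q" by (simp add: algebra_simps)
      show "0 < q ^ k0 * (1 - q) ^ n" using q by simp
    qed
    also have "\<dots> = q ^ k0 * (1 - q) ^ (m - k0)" by (simp add: mk)
    finally show ?thesis using split lead by linarith
  qed
qed

text \<open>Were the first nonzero coefficient negative, \<open>bernstein_pos\<close> for
  \<open>- d\<close> would make the sum negative arbitrarily close to 0.\<close>

lemma bernstein_nonneg:
  fixes d :: "nat \<Rightarrow> int" and \<epsilon> q :: real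
  assumes d: "\<And>k. k \<le> m \<Longrightarrow> \<bar>d k\<bar> \<le> int (m choose k)"
    and "\<epsilon> > 0"
    and nn: "\<And>q :: real. 0 < q \<Longrightarrow> q < 1 \<Longrightarrow> q < \<epsilon> \<Longrightarrow> (\<Sum>k\<le>m. d k * (q ^ k * (1 - q) ^ (m - k))) \<ge> 0"
    and q: "0 < q" "q < 1" "q < 1 / 3 ^ m"
  shows "(\<Sum>k\<le>m. d k * (q ^ k * (1 - q) ^ (m - k))) \<ge> 0"
proof (cases "\<exists>k\<le>m. d k \<noteq> 0")
  case False
  then show ?thesis by simp
next
  case True
  define k0 where "k0 = (LEAST k. k \<le> m \<and> d k \<noteq> 0)"
  have k0: "k0 \<le> m" "d k0 \<noteq> 0" using LeastI_ex[OF True] by (auto simp: k0_def)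
  have less: "d k = 0" if "k < k0" for k
    using not_less_Least[of k "\<lambda>k. k \<le> m \<and> d k \<noteq> 0"] that k0 by (auto simp: k0_def)
  show ?thesis
  proof (cases "d k0 > 0")
    case True
    then show ?thesis using bernstein_pos[OF d k0(1) True less q] by simp
  next
    case False
    \<comment> \<open>Small enough for both the assumption near 0 and the bound
      \<open>1 / 3 ^ m\<close>.\<close>
    define t :: real where "t = min q (\<epsilon> / 2)"
    have t: "0 < t" "t < 1" "t < 1 / 3 ^ m" "t < \<epsilon>" using q \<open>\<epsilon> > 0\<close> by (auto simp: t_def min_def)
    have "0 < (\<Sum>k\<le>m. (- d k) * (t ^ k * (1 - t) ^ (m - k)))"
      using bernstein_pos[of m "\<lambda>k. - d k" k0 t] d k0 less False t by auto
    then have False using nn[OF t(1,2,4)] by (simp add: sum_negf)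
    then show ?thesis ..
  qed
qed

text \<open>Carries a comparison from an unspecified neighbourhood of 1 to a range that depends only
  on the number of edges.\<close>

lemma rho_diff_nonneg:
  assumes "finite E" and "\<epsilon> > 0"
    and nn: "\<And>p. 0 < p \<Longrightarrow> p < 1 \<Longrightarrow> 1 - \<epsilon> < p \<Longrightarrow> rho E s r A p \<le> rho E s r B p"
    and p: "0 < p" "p < 1" "1 - p < 1 / 3 ^ card E"
  shows "rho E s r A p \<le> rho E s r B p"
proof -
  define N where "N A k = {F. F \<subseteq> E \<and> survives E s r A F \<and> card F = k}" for A k
  define d where "d k = int (card (N B k)) - int (card (N A k))" for k
  have N: "card (N A k) \<le> card E choose k" for A k
  proof -
    have "card (N A k) \<le> card {F. F \<subseteq> E \<and> card F = k}"
      by (rule card_mono) (use assms in \<open>auto simp: N_def\<close>)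
    then show ?thesis using n_subsets[OF assms(1)] by simp
  qed
  have diff: "(\<Sum>k\<le>card E. d k * (q ^ k * (1 - q) ^ (card E - k))) = rho E s r B (1 - q) - rho E s r A (1 - q)"
    if "0 < q" "q < 1" for q :: real
    using rho_bernstein[OF assms(1), of "1 - q" s r] that
    by (simp add: d_def N_def left_diff_distrib sum_subtractf)
  have "0 \<le> (\<Sum>k\<le>card E. d k * ((1 - p) ^ k * (1 - (1 - p)) ^ (card E - k)))"
  proof (rule bernstein_nonneg[OF _ \<open>\<epsilon> > 0\<close>])
    \<comment> \<open>Both counts lie between 0 and the binomial coefficient, so their difference
      obeys the same bound.\<close>
    show "\<bar>d k\<bar> \<le> int (card E choose k)" for k using N[of A k] N[of B k] by (simp add: d_def)
    show "0 \<le> (\<Sum>k\<le>card E. d k * (q ^ k * (1 - q) ^ (card E - k)))" if "0 < q" "q < 1" "q < \<epsilon>" for q :: real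
      using diff[OF that(1,2)] nn[of "1 - q"] that by simp
  qed (use p in auto)
  then show ?thesis using diff[of "1 - p"] p by simp
qed

section \<open>Optimality, and estimates of the failure probability by cuts\<close>

lemma rho_le_rho_hat:
  assumes "simple_graph V E" "finite_protocol E s r A"
  shows "rho E s r A p \<le> rho_hat E s r p"
  unfolding rho_hat_def
  by (rule Max_ge) (use finite_finite_protocols[OF assms(1)] assms(2) in auto)

text \<open>A walk that avoids \<open>C\<close> can never step out of \<open>S\<close>.\<close>

lemma cut_disconnects:
  assumes "simple_graph V E" "C \<in> separating_cuts V E s r" "s \<in> V"
  shows "\<not> survives E s r A C"
proof
  assume "survives E s r A C"
  then obtain xs where xs: "walk E s r xs" "walk_edges xs \<inter> C = {}"
    by (auto simp: survives_def protocol_walks_def)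
  obtain S where S: "C = cut_edges V E S" "S \<subseteq> V" "s \<in> S" "r \<notin> S"
    using assms(2) by (auto simp: separating_cuts_def)
  have "xs ! i \<in> S" if "i < length xs" for i
    using that
  proof (induction i)
    case 0
    then show ?case using xs S by (auto simp: walk_def hd_conv_nth)
  next
    case (Suc i)
    have e: "{xs ! i, xs ! Suc i} \<in> E" "{xs ! i, xs ! Suc i} \<in> walk_edges xs"
      using xs(1) Suc.prems by (auto simp: walk_def walk_edges_def)
    then have "{xs ! i, xs ! Suc i} \<notin> C" "xs ! Suc i \<in> V"
      using xs(2) assms(1) by (auto simp: simple_graph_def)
    then show ?case using Suc e(1) S(1) by (auto simp: cut_edges_def)
  qed
  then show False using xs(1) S(4) by (auto simp: walk_def last_conv_nth)
qed

text \<open>Only failure sets that are cuts of size \<open>k\<close> are kept; Bernoulli's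
  inequality bounds the probability of each from below.\<close>

lemma one_minus_rho_ge:
  assumes G: "simple_graph V E" and "s \<in> V" and q: "0 < q" "q < 1"
  shows "1 - rho E s r A (1 - q) \<ge>
    real (num_cuts V E s r k) * (q ^ k - real (card E) * q ^ Suc k)"
proof -
  let ?C = "{C \<in> separating_cuts V E s r. card C = k}"
  have fE: "finite E" by (rule finite_edges[OF G])
  have "real (num_cuts V E s r k) * (q ^ k - real (card E) * q ^ Suc k) =
      (\<Sum>F\<in>?C. q ^ k - real (card E) * q ^ Suc k)" by (simp add: num_cuts_def)
  also have "\<dots> \<le> (\<Sum>F\<in>?C. q ^ card F * (1 - q) ^ (card E - card F))"
  proof (rule sum_mono)
    fix F assume F: "F \<in> ?C"
    have "1 - real (card E) * q \<le> 1 - real (card E - k) * q" using q by (simp add: mult_right_mono)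
    also have "\<dots> \<le> (1 - q) ^ (card E - k)"
      using Bernoulli_inequality[of "- q" "card E - k"] q by simp
    finally have "q ^ k * (1 - real (card E) * q) \<le> q ^ k * (1 - q) ^ (card E - k)"
      using q by (intro mult_left_mono) auto
    then show "q ^ k - real (card E) * q ^ Suc k \<le> q ^ card F * (1 - q) ^ (card E - card F)"
      using F by (simp add: algebra_simps)
  qed
  also have "\<dots> \<le> (\<Sum>F | F \<subseteq> E \<and> \<not> survives E s r A F. q ^ card F * (1 - q) ^ (card E - card F))"
  proof (rule sum_mono2)
    show "?C \<subseteq> {F. F \<subseteq> E \<and> \<not> survives E s r A F}"
      using cut_disconnects[OF G _ assms(2)] by (auto simp: separating_cuts_def cut_edges_def)
  qed (use fE q in auto)
  also have "\<dots> = 1 - rho E s r A (1 - q)"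
    using one_minus_rho_eq_sum[OF fE, of "1 - q"] q by simp
  finally show ?thesis .
qed

text \<open>A failure set that \<open>A\<close> does not survive is a cut of size \<open>k\<close>
  or has more than \<open>k\<close> edges. There are at most \<open>2 ^ card E\<close> sets of the
  second kind, each of probability at most \<open>q ^ Suc k\<close>.\<close>

lemma one_minus_rho_le:
  assumes G: "simple_graph V E" and q: "0 < q" "q < 1"
    and min: "\<And>C. C \<in> separating_cuts V E s r \<Longrightarrow> k \<le> card C"
    and A: "\<And>F. F \<subseteq> E \<Longrightarrow> card F \<le> k \<Longrightarrow> F \<notin> separating_cuts V E s r \<Longrightarrow> survives E s r A F"
  shows "1 - rho E s r A (1 - q) \<le> real (num_cuts V E s r k) * q ^ k + 2 ^ card E * q ^ Suc k"
proof -
  let ?C = "{C \<in> separating_cuts V E s r. card C = k}"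
  let ?w = "\<lambda>F. q ^ card F * (1 - q) ^ (card E - card F)"
  have fE: "finite E" by (rule finite_edges[OF G])
  have fC: "finite ?C" using finite_separating_cuts[OF G] by simp
  let ?L = "{F. F \<subseteq> E \<and> k < card F}"
  have w: "?w F \<le> q ^ card F" for F :: "'a set set"
    using q by (simp add: mult_left_le power_le_one)
  have "1 - rho E s r A (1 - q) = (\<Sum>F | F \<subseteq> E \<and> \<not> survives E s r A F. ?w F)"
    using one_minus_rho_eq_sum[OF fE, of "1 - q"] q by simp
  also have "\<dots> \<le> (\<Sum>F\<in>?C \<union> ?L. ?w F)"
  proof (rule sum_mono2)
    show "{F. F \<subseteq> E \<and> \<not> survives E s r A F} \<subseteq> ?C \<union> ?L"
    proof
      fix F assume F: "F \<in> {F. F \<subseteq> E \<and> \<not> survives E s r A F}"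
      show "F \<in> ?C \<union> ?L"
      proof (cases "card F \<le> k")
        case True
        then have "F \<in> separating_cuts V E s r" using A F by blast
        then show ?thesis using min[of F] True by simp
      qed (use F in auto)
    qed
  qed (use fE fC q in auto)
  also have "\<dots> = (\<Sum>F\<in>?C. ?w F) + (\<Sum>F\<in>?L. ?w F)"
    by (rule sum.union_disjoint) (use fE fC in auto)
  also have "\<dots> \<le> (\<Sum>F\<in>?C. q ^ k) + (\<Sum>F\<in>?L. q ^ Suc k)"
  proof (intro add_mono sum_mono)
    show "?w F \<le> q ^ k" if "F \<in> ?C" for F using w[of F] that by simp
    show "?w F \<le> q ^ Suc k" if "F \<in> ?L" for F
      by (rule order.trans[OF w power_decreasing]) (use that q in auto)
  qed
  also have "\<dots> = real (num_cuts V E s r k) * q ^ k + real (card ?L) * q ^ Suc k"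
    by (simp add: num_cuts_def)
  also have "real (card ?L) * q ^ Suc k \<le> 2 ^ card E * q ^ Suc k"
  proof (rule mult_right_mono)
    have "card ?L \<le> card (Pow E)" by (rule card_mono) (use fE in auto)
    then show "real (card ?L) \<le> 2 ^ card E" using fE by (simp add: card_Pow)
  qed (use q in simp)
  finally show ?thesis by simp
qed

theorem theorem9p1:
  fixes V :: "'v set" and E :: "'v set set" and s r :: 'v
    and A\<^sub>1 :: "('v \<times> 'v \<times> 'v) set" and m e c :: nat
  assumes "simple_graph V E" and "s \<in> V" and "r \<in> V" and "s \<noteq> r"
    and "m = card E"
    and "e = min_cut_size V E s r"
    and "c = num_cuts V E s r e"
    and "finite_protocol E s r A\<^sub>1"
    and "\<exists>\<epsilon>>0. \<forall>p. 0 < p \<and> p < 1 \<and> 1 - \<epsilon> < p \<longrightarrow> rho_hat E s r p = rho E s r A\<^sub>1 p"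
  shows "(\<forall>p. 0 < p \<and> p < 1 \<and> 1 - p < 1 / 3 ^ m \<longrightarrow> rho_hat E s r p = rho E s r A\<^sub>1 p) \<and>
    (\<lambda>q. rho E s r A\<^sub>1 (1 - q) - (1 - real c * q ^ e)) \<in> O[at_right 0](\<lambda>q. q ^ (e + 1))"
proof -
  note G = assms(1)
  obtain \<epsilon> where \<epsilon>: "\<epsilon> > 0"
    "\<And>p. 0 < p \<Longrightarrow> p < 1 \<Longrightarrow> 1 - \<epsilon> < p \<Longrightarrow> rho_hat E s r p = rho E s r A\<^sub>1 p"
    using assms(9) by blast
  have near: "rho E s r A p \<le> rho E s r A\<^sub>1 p"
    if "finite_protocol E s r A" "0 < p" "p < 1" "1 - \<epsilon> < p" for A p
    using rho_le_rho_hat[OF G that(1)] \<epsilon>(2)[OF that(2-)] by metis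
  have "rho_hat E s r p = rho E s r A\<^sub>1 p" if p: "0 < p" "p < 1" "1 - p < 1 / 3 ^ m" for p
  proof (rule antisym)
    have "rho E s r A p \<le> rho E s r A\<^sub>1 p" if "finite_protocol E s r A" for A
      using rho_diff_nonneg[OF finite_edges[OF G] \<epsilon>(1) near[OF that]] p assms(5) by simp
    then show "rho_hat E s r p \<le> rho E s r A\<^sub>1 p"
      unfolding rho_hat_def
      using finite_finite_protocols[OF G] finite_protocol_empty[of E s r] by (subst Max_le_iff) auto
  qed (rule rho_le_rho_hat[OF G assms(8)])
  moreover have "(\<lambda>q. rho E s r A\<^sub>1 (1 - q) - (1 - real c * q ^ e)) \<in> O[at_right 0](\<lambda>q. q ^ (e + 1))"
  proof -
    obtain A where A: "finite_protocol E s r A"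
      "\<And>F. F \<subseteq> E \<Longrightarrow> card F \<le> e \<Longrightarrow> F \<notin> separating_cuts V E s r \<Longrightarrow> survives E s r A F"
      using ex_resilient_protocol[OF G assms(2,4)] unfolding assms(6) survives_def by metis
    have min: "e \<le> card C" if "C \<in> separating_cuts V E s r" for C
      unfolding assms(6) min_cut_size_def
      by (rule Min_le) (use finite_separating_cuts[OF G] that in auto)
    \<comment> \<open>The first summand stems from the resilient protocol \<open>A\<close>, the
      second from the bound valid for every protocol.\<close>
    define K where "K = 2 ^ m + real c * real m"
    have bound: "\<bar>rho E s r A\<^sub>1 (1 - q) - (1 - real c * q ^ e)\<bar> \<le> K * q ^ (e + 1)"
      if q: "0 < q" "q < 1" "q < \<epsilon>" for q
    proof -
      \<comment> \<open>Optimality near one transfers the upper bound on the failure probability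
        from \<open>A\<close> to \<open>A\<^sub>1\<close>.\<close>
      have "rho E s r A (1 - q) \<le> rho E s r A\<^sub>1 (1 - q)" using near[OF A(1)] q by simp
      moreover have "1 - rho E s r A (1 - q) \<le> real c * q ^ e + 2 ^ m * q ^ Suc e"
        using one_minus_rho_le[OF G q(1,2) min A(2)] assms(5,7) by simp
      moreover have "1 - rho E s r A\<^sub>1 (1 - q) \<ge> real c * q ^ e - real c * real m * q ^ Suc e"
        using one_minus_rho_ge[OF G assms(2) q(1,2), where A = A\<^sub>1 and k = e and r = r] assms(5,7)
        by (simp add: algebra_simps)
      moreover have "0 \<le> real c * real m * q ^ Suc e" "0 \<le> 2 ^ m * q ^ Suc e" using q by auto
      ultimately show ?thesis unfolding K_def by (simp add: distrib_right abs_le_iff)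
    qed
    have "\<forall>\<^sub>F q in at_right 0. norm (rho E s r A\<^sub>1 (1 - q) - (1 - real c * q ^ e)) \<le> K * norm (q ^ (e + 1))"
      unfolding eventually_at_right_field
      using bound \<epsilon>(1) by (intro exI[of _ "min 1 \<epsilon>"]) auto
    then show ?thesis by (rule bigoI)
  qed
  ultimately show ?thesis by blast
qed

end
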